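(* Let $\langle\mathcal S,\mathcal A,\mathcal P,\mathcal R,\gamma\rangle$ be a discounted Markov decision process with $\gamma\in(0,1)$, let $\alpha>0$, and let $\pi$ be a stationary policy. Assume: (a) for each $s\in\mathcal S$, if $a\sim\pi(\cdot\mid s)$, then $\log\pi(a\mid s)$ is well defined almost surely; (b) $\sup_{(s,a)\in\mathcal S\times\mathcal A}\mathbb E_{r\sim R(s,a),\,(s',a')\sim\mathcal P^\pi(\cdot\mid s,a)}\bigl[|r-\gamma\alpha\log\pi(a'\mid s')|\bigr]<\infty$; (c) for every $F\in\mathcal X^{\mathrm{cdf}}$ and $x\in\mathbb R$, the map $(s,a)\mapsto\mathbb E_{r\sim R(s,a),\,(s',a')\sim\mathcal P^\pi(\cdot\mid s,a)}\bigl[F(s',a')\bigl(\tfrac{x-r}{\gamma}+\alpha\log\pi(a'\mid s')\bigr)\bigr]$ is measurable. Let $\mathcal Z$ be a return-distribution field whose CDF field satisfies $F_{\mathcal Z}\in\mathcal X^{\mathrm{cdf}}$. Then $F_{\mathcal T^\pi_{DS}\mathcal Z}=\mathcal T^\pi_{\mathrm{cdf}}F_{\mathcal Z}$.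
   Context: MDP: $\mathcal S,\mathcal A$ are measurable spaces (states, actions), $\mathcal P(\cdot\mid s,a)$ is a transition kernel on $\mathcal S$, $\mathcal R:\mathcal S\times\mathcal A\times\mathcal S\to\mathbb R$ is a (measurable) reward function. A stationary policy $\pi$ assigns to each $s$ a probability distribution $\pi(\cdot\mid s)$ on $\mathcal A$; $\pi(a\mid s)$ denotes the value of its probability mass function / density. Sampling: $(s',a')\sim\mathcal P^\pi(\cdot\mid s,a)$ means $s'\sim\mathcal P(\cdot\mid s,a)$ and then $a'\sim\pi(\cdot\mid s')$; $r\sim R(s,a)$ denotes the one-step reward $r=\mathcal R(s,a,s')$ generated by the same next state $s'$ (the corresponding random variable is written $R(s,a)$). A return-distribution field is a map $\mathcal Z$ from $\mathcal S\times\mathcal A$ to probability laws on $\mathbb R$; its CDF field is $F_{\mathcal Z}(s,a)(x):=F_{\mathcal Z(s,a)}(x)$, the CDF of $\mathcal Z(s,a)$. The distributional soft Bellman operator is $(\mathcal T^\pi_{DS}\mathcal Z)(s,a):=\mathrm{Law}\bigl(R(s,a)+\gamma(Z'-\alpha\log\pi(a'\mid s'))\bigr)$, where $(s',a')\sim\mathcal P^\pi(\cdot\mid s,a)$ and, conditionally on $(s',a')$, $Z'\sim\mathcal Z(s',a')$. Cramér distance: $d_C(P_1,P_2)=\bigl(\int_{\mathbb R}(F_{P_1}(x)-F_{P_2}(x))^2dx\bigr)^{1/2}$. $\delta_0$ is the Dirac law at $0$. $\Gamma_F$ is the set of CDFs $F_P$ of laws $P$ on $\mathbb R$ with $d_C(P,\delta_0)<\infty$.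 $\mathcal X^{\mathrm{cdf}}$ is the set of all CDF fields $F:(s,a)\mapsto F(s,a)\in\Gamma_F$ (with $(s,a)\mapsto F(s,a)(x)$ measurable for each $x\in\mathbb R$) such that $\sup_{(s,a)}\int_{\mathbb R}(F(s,a)(x)-\mathbf 1\{x\ge0\})^2dx<\infty$. CDF-level operator: for $F\in\mathcal X^{\mathrm{cdf}}$, $(\mathcal T^\pi_{\mathrm{cdf}}F)(s,a)(x):=\mathbb E_{r\sim R(s,a),\,(s',a')\sim\mathcal P^\pi(\cdot\mid s,a)}\bigl[F(s',a')\bigl(\tfrac{x-r}{\gamma}+\alpha\log\pi(a'\mid s')\bigr)\bigr]$. *)

theory Defs
  imports "HOL-Probability.Probability"
begin

text \<open>
  States and actions are measurable spaces \<open>S\<close>, \<open>A\<close> with explicit carriers \<open>space S\<close>,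
  \<open>space A\<close>; a field over state-action pairs is a function on pairs of which only the values on
  \<open>space (S \<Otimes>\<^sub>M A)\<close> matter. Probability kernels are measurable maps into \<open>prob_algebra\<close>.
\<close>

locale discounted_mdp =
  fixes S :: "'s measure" and A :: "'a measure"
    and P :: "'s \<times> 'a \<Rightarrow> 's measure"
    and R :: "'s \<times> 'a \<times> 's \<Rightarrow> real"
    and \<gamma> :: real
  assumes transition_kernel: "P \<in> (S \<Otimes>\<^sub>M A) \<rightarrow>\<^sub>M prob_algebra S"
    and reward_measurable: "R \<in> borel_measurable (S \<Otimes>\<^sub>M A \<Otimes>\<^sub>M S)"
    and discount_pos: "0 < \<gamma>"
    and discount_less_1: "\<gamma> < 1"

text \<open>
  The value \<open>\<pi>(a | s)\<close> of the mass function or density is \<open>p s a\<close>, where \<open>p s\<close> is a density of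
  the law \<open>\<pi> s\<close> with respect to a reference measure \<open>\<nu>\<close> on the actions: \<open>\<nu>\<close> is a counting
  measure for mass functions and, for instance, Lebesgue measure for densities.
\<close>

locale stationary_policy =
  fixes S :: "'s measure" and A :: "'a measure" and \<nu> :: "'a measure"
    and \<pi> :: "'s \<Rightarrow> 'a measure"
    and p :: "'s \<Rightarrow> 'a \<Rightarrow> real"
  assumes policy_kernel: "\<pi> \<in> S \<rightarrow>\<^sub>M prob_algebra A"
    and sets_reference: "sets \<nu> = sets A"
    and density_measurable: "(\<lambda>(s, a). p s a) \<in> borel_measurable (S \<Otimes>\<^sub>M A)"
    and density_nonneg: "\<And>s a. s \<in> space S \<Longrightarrow> a \<in> space A \<Longrightarrow> 0 \<le> p s a"
    and policy_density: "\<And>s. s \<in> space S \<Longrightarrow> \<pi> s = density \<nu> (\<lambda>a. ennreal (p s a))"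

definition next_pair ::
  "'s measure \<Rightarrow> 'a measure \<Rightarrow> ('s \<times> 'a \<Rightarrow> 's measure) \<Rightarrow> ('s \<Rightarrow> 'a measure)
    \<Rightarrow> 's \<times> 'a \<Rightarrow> ('s \<times> 'a) measure" where
  "next_pair S A P \<pi> sa =
     P sa \<bind> (\<lambda>s'. \<pi> s' \<bind> (\<lambda>a'. return (S \<Otimes>\<^sub>M A) (s', a')))"

definition next_pair_return ::
  "'s measure \<Rightarrow> 'a measure \<Rightarrow> ('s \<times> 'a \<Rightarrow> 's measure) \<Rightarrow> ('s \<Rightarrow> 'a measure)
    \<Rightarrow> ('s \<times> 'a \<Rightarrow> real measure) \<Rightarrow> 's \<times> 'a \<Rightarrow> (('s \<times> 'a) \<times> real) measure" where
  "next_pair_return S A P \<pi> Z sa =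
     next_pair S A P \<pi> sa \<bind>
       (\<lambda>sa'. Z sa' \<bind> (\<lambda>z. return ((S \<Otimes>\<^sub>M A) \<Otimes>\<^sub>M borel) (sa', z)))"

definition return_distribution_field ::
  "'s measure \<Rightarrow> 'a measure \<Rightarrow> ('s \<times> 'a \<Rightarrow> real measure) \<Rightarrow> bool" where
  "return_distribution_field S A Z \<longleftrightarrow> (\<forall>sa\<in>space (S \<Otimes>\<^sub>M A). real_distribution (Z sa))"

definition cdf_field :: "('s \<times> 'a \<Rightarrow> real measure) \<Rightarrow> 's \<times> 'a \<Rightarrow> real \<Rightarrow> real" where
  "cdf_field Z sa = cdf (Z sa)"

text \<open>
  The reward is a function of the sampled next state, so the same \<open>s'\<close> enters the reward and the
  log-density. The convention \<open>ln 0 = 0\<close> is only relevant where \<open>p\<close> vanishes.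
\<close>

definition soft_bellman ::
  "'s measure \<Rightarrow> 'a measure \<Rightarrow> ('s \<times> 'a \<Rightarrow> 's measure) \<Rightarrow> ('s \<times> 'a \<times> 's \<Rightarrow> real) \<Rightarrow> real \<Rightarrow> real
    \<Rightarrow> ('s \<Rightarrow> 'a measure) \<Rightarrow> ('s \<Rightarrow> 'a \<Rightarrow> real)
    \<Rightarrow> ('s \<times> 'a \<Rightarrow> real measure) \<Rightarrow> 's \<times> 'a \<Rightarrow> real measure" where
  "soft_bellman S A P R \<gamma> \<alpha> \<pi> p Z = (\<lambda>(s, a).
     distr (next_pair_return S A P \<pi> Z (s, a)) borel
       (\<lambda>((s', a'), z). R (s, a, s') + \<gamma> * (z - \<alpha> * ln (p s' a'))))"

definition cdf_bellman ::
  "'s measure \<Rightarrow> 'a measure \<Rightarrow> ('s \<times> 'a \<Rightarrow> 's measure) \<Rightarrow> ('s \<times> 'a \<times> 's \<Rightarrow> real) \<Rightarrow> real \<Rightarrow> real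
    \<Rightarrow> ('s \<Rightarrow> 'a measure) \<Rightarrow> ('s \<Rightarrow> 'a \<Rightarrow> real)
    \<Rightarrow> ('s \<times> 'a \<Rightarrow> real \<Rightarrow> real) \<Rightarrow> 's \<times> 'a \<Rightarrow> real \<Rightarrow> real" where
  "cdf_bellman S A P R \<gamma> \<alpha> \<pi> p F = (\<lambda>(s, a) x.
     \<integral>(s', a'). F (s', a') ((x - R (s, a, s')) / \<gamma> + \<alpha> * ln (p s' a'))
       \<partial>next_pair S A P \<pi> (s, a))"

definition cramer_distance :: "real measure \<Rightarrow> real measure \<Rightarrow> ennreal" where
  "cramer_distance P Q =
     (let I = \<integral>\<^sup>+x. ennreal ((cdf P x - cdf Q x)\<^sup>2) \<partial>lborel
      in if I = \<infinity> then \<infinity> else ennreal (sqrt (enn2real I)))"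

definition cdf_space :: "(real \<Rightarrow> real) set" where
  "cdf_space = {cdf P | P. real_distribution P \<and> cramer_distance P (return borel 0) < \<infinity>}"

definition cdf_fields :: "'s measure \<Rightarrow> 'a measure \<Rightarrow> ('s \<times> 'a \<Rightarrow> real \<Rightarrow> real) set" where
  "cdf_fields S A =
     {F. (\<forall>sa\<in>space (S \<Otimes>\<^sub>M A). F sa \<in> cdf_space) \<and>
         (\<forall>x. (\<lambda>sa. F sa x) \<in> borel_measurable (S \<Otimes>\<^sub>M A)) \<and>
         (SUP sa\<in>space (S \<Otimes>\<^sub>M A).
            \<integral>\<^sup>+x. ennreal ((F sa x - indicator {0..} x)\<^sup>2) \<partial>lborel) < \<infinity>}"

end

theory Submission
  imports Defs
begin

text \<open>
  Half-lines generate the Borel sets and are closed under intersection, so measurability of the CDFs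
  at each point already makes \<open>Z\<close> a Markov kernel. This is what gives the iterated bind defining the
  Bellman target its meaning, and conditioning on \<open>(s', a')\<close> leaves the law of \<open>Z(s', a')\<close> on a set
  that is again a half-line, because \<open>\<gamma> > 0\<close>.
\<close>

lemma measurable_prob_algebra_borel_cdf:
  fixes Z :: "'b \<Rightarrow> real measure"
  assumes dist: "\<And>w. w \<in> space M \<Longrightarrow> real_distribution (Z w)"
    and meas: "\<And>x. (\<lambda>w. cdf (Z w) x) \<in> borel_measurable M"
  shows "Z \<in> M \<rightarrow>\<^sub>M prob_algebra borel"
proof (rule measurable_prob_algebra_generated[where \<Omega> = UNIV and G = "range atMost"])
  show "sets borel = sigma_sets UNIV (range (atMost :: real \<Rightarrow> real set))"
    by (subst borel_eq_atMost) simp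
  show "Int_stable (range (atMost :: real \<Rightarrow> real set))"
    by (auto simp: Int_stable_def)
  show "range atMost \<subseteq> Pow (UNIV :: real set)"
    by simp
  fix w assume w: "w \<in> space M"
  interpret real_distribution "Z w"
    using dist[OF w] .
  show "prob_space (Z w)"
    by unfold_locales
  show "sets (Z w) = sets borel"
    by simp
next
  fix B :: "real set" assume "B \<in> range atMost"
  then obtain x where B: "B = {..x}"
    by blast
  \<comment> \<open>Off \<open>space M\<close> nothing is known about \<open>Z w\<close>, so the
    passage from \<open>emeasure\<close> to the real-valued CDF is made by a congruence on
    \<open>space M\<close>, where \<open>Z w\<close> is finite.\<close>
  have "(\<lambda>w. emeasure (Z w) B) \<in> borel_measurable M \<longleftrightarrow>
      (\<lambda>w. ennreal (cdf (Z w) x)) \<in> borel_measurable M"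
  proof (rule measurable_cong)
    fix w assume w: "w \<in> space M"
    interpret real_distribution "Z w"
      using dist[OF w] .
    show "emeasure (Z w) B = ennreal (cdf (Z w) x)"
      by (simp add: B cdf_def emeasure_eq_measure)
  qed
  then show "(\<lambda>w. emeasure (Z w) B) \<in> borel_measurable M"
    using meas[of x] by simp
qed

text \<open>Composing Markov kernels gives a Markov kernel. Only its value at one pair is kept: this
  is the mixing law over which the target is averaged.\<close>

lemma next_pair_in_space_prob_algebra:
  assumes P: "P \<in> S \<Otimes>\<^sub>M A \<rightarrow>\<^sub>M prob_algebra S"
    and \<pi>: "\<pi> \<in> S \<rightarrow>\<^sub>M prob_algebra A"
    and sa: "sa \<in> space (S \<Otimes>\<^sub>M A)"
  shows "next_pair S A P \<pi> sa \<in> space (prob_algebra (S \<Otimes>\<^sub>M A))"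
proof -
  note [measurable] = P \<pi>
  have "next_pair S A P \<pi> \<in> S \<Otimes>\<^sub>M A \<rightarrow>\<^sub>M prob_algebra (S \<Otimes>\<^sub>M A)"
    unfolding next_pair_def
    by measurable
  then show ?thesis
    using sa by (rule measurable_space)
qed

text \<open>Disintegration: the joint law of \<open>w\<close> and \<open>z\<close> gives an event
  the \<open>N\<close>-average of the \<open>Z w\<close>-measures of its slices at \<open>w\<close>.
  Applied to the preimage of \<open>B\<close> under \<open>f\<close>, this turns the law of a random
  target into a mixture.\<close>

lemma measure_distr_bind_pair:
  assumes N: "N \<in> space (prob_algebra M)"
    and Z [measurable]: "Z \<in> M \<rightarrow>\<^sub>M prob_algebra L"
    and f [measurable]: "f \<in> M \<Otimes>\<^sub>M L \<rightarrow>\<^sub>M K"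
    and B [measurable]: "B \<in> sets K"
  shows "measure (distr (N \<bind> (\<lambda>w. Z w \<bind> (\<lambda>z. return (M \<Otimes>\<^sub>M L) (w, z)))) K f) B
    = (\<integral>w. measure (Z w) {z \<in> space L. f (w, z) \<in> B} \<partial>N)"
proof -
  let ?K = "\<lambda>w. Z w \<bind> (\<lambda>z. return (M \<Otimes>\<^sub>M L) (w, z))"
  let ?C = "f -` B \<inter> space (M \<Otimes>\<^sub>M L)"
  have sets_N [measurable_cong]: "sets N = sets M" and prob_N: "prob_space N"
    using N by (auto simp: space_prob_algebra)
  interpret N: prob_space N
    by (rule prob_N)
  have K: "?K \<in> M \<rightarrow>\<^sub>M prob_algebra (M \<Otimes>\<^sub>M L)"
    by measurable
  \<comment> \<open>The formula for the measure of a bind wants a subprobability kernel on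
    \<open>N\<close> itself, which shares its sigma-algebra with \<open>M\<close>.\<close>
  have K': "?K \<in> N \<rightarrow>\<^sub>M subprob_algebra (M \<Otimes>\<^sub>M L)"
    using measurable_prob_algebraD[OF K] by (simp cong: measurable_cong_sets add: sets_N)
  have C: "?C \<in> sets (M \<Otimes>\<^sub>M L)"
    by measurable
  \<comment> \<open>\<open>bind\<close> reads its sigma-algebra off the kernel at some point of the
    space, hence the appeal to nonemptiness of \<open>N\<close>.\<close>
  have sets_bind: "sets (N \<bind> ?K) = sets (M \<Otimes>\<^sub>M L)"
    using K' by (rule sets_bind_measurable) (rule N.not_empty)
  have "measure (distr (N \<bind> ?K) K f) B = measure (N \<bind> ?K) ?C"
    by (subst measure_distr) (simp_all add: sets_eq_imp_space_eq[OF sets_bind]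
        measurable_cong_sets[OF sets_bind refl])
  also have "\<dots> = (\<integral>w. measure (?K w) ?C \<partial>N)"
    by (rule N.measure_bind[OF K' C])
  also have "\<dots> = (\<integral>w. measure (Z w) {z \<in> space L. f (w, z) \<in> B} \<partial>N)"
  proof (rule Bochner_Integration.integral_cong[OF refl])
    fix w assume "w \<in> space N"
    then have w [measurable]: "w \<in> space M"
      using sets_eq_imp_space_eq[OF sets_N] by simp
    have Zw: "sets (Z w) = sets L" "prob_space (Z w)"
      using measurable_space[OF Z w] by (auto simp: space_prob_algebra)
    interpret Zw: prob_space "Z w"
      by (rule Zw)
    have pair: "Pair w \<in> Z w \<rightarrow>\<^sub>M M \<Otimes>\<^sub>M L"
      using w by (simp cong: measurable_cong_sets add: Zw)
    \<comment> \<open>With \<open>w\<close> frozen, the inner bind is a pushforward along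
      \<open>Pair w\<close>, so the measure of \<open>?C\<close> becomes that of its slice at
      \<open>w\<close>.\<close>
    have "?K w = distr (Z w) (M \<Otimes>\<^sub>M L) (Pair w)"
      using bind_return_distr'[OF Zw.not_empty pair] by simp
    then have "measure (?K w) ?C = measure (Z w) (Pair w -` ?C \<inter> space (Z w))"
      using measure_distr[OF pair C] by simp
    also have "Pair w -` ?C \<inter> space (Z w) = {z \<in> space L. f (w, z) \<in> B}"
      using w sets_eq_imp_space_eq[OF Zw(1)] by (auto simp: space_pair_measure)
    finally show "measure (?K w) ?C = measure (Z w) {z \<in> space L. f (w, z) \<in> B}" .
  qed
  finally show ?thesis .
qed

theorem proposition6:
  fixes S :: "'s measure" and A :: "'a measure" and \<nu> :: "'a measure"
    and P :: "'s \<times> 'a \<Rightarrow> 's measure"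
    and R :: "'s \<times> 'a \<times> 's \<Rightarrow> real"
    and \<gamma> \<alpha> :: real
    and \<pi> :: "'s \<Rightarrow> 'a measure" and p :: "'s \<Rightarrow> 'a \<Rightarrow> real"
    and Z :: "'s \<times> 'a \<Rightarrow> real measure"
  assumes mdp: "discounted_mdp S A P R \<gamma>"
    and policy: "stationary_policy S A \<nu> \<pi> p"
    and temperature: "\<alpha> > 0"
    and log_defined: "\<And>s. s \<in> space S \<Longrightarrow> AE a in \<pi> s. 0 < p s a"
    and bounded_reward:
      "(SUP (s, a)\<in>space (S \<Otimes>\<^sub>M A).
          \<integral>\<^sup>+(s', a'). ennreal \<bar>R (s, a, s') - \<gamma> * \<alpha> * ln (p s' a')\<bar>
            \<partial>next_pair S A P \<pi> (s, a)) < \<infinity>"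
    and measurable_update:
      "\<And>F x. F \<in> cdf_fields S A \<Longrightarrow>
         (\<lambda>(s, a). \<integral>(s', a'). F (s', a') ((x - R (s, a, s')) / \<gamma> + \<alpha> * ln (p s' a'))
            \<partial>next_pair S A P \<pi> (s, a)) \<in> borel_measurable (S \<Otimes>\<^sub>M A)"
    and field: "return_distribution_field S A Z"
    and cdf_field: "cdf_field Z \<in> cdf_fields S A"
  shows "\<forall>sa\<in>space (S \<Otimes>\<^sub>M A).
           cdf_field (soft_bellman S A P R \<gamma> \<alpha> \<pi> p Z) sa
             = cdf_bellman S A P R \<gamma> \<alpha> \<pi> p (cdf_field Z) sa"
proof
  fix sa assume sa: "sa \<in> space (S \<Otimes>\<^sub>M A)"
  obtain s a where sa_eq: "sa = (s, a)"
    by (cases sa)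
  interpret mdp: discounted_mdp S A P R \<gamma>
    by (rule mdp)
  interpret policy: stationary_policy S A \<nu> \<pi> p
    by (rule policy)
  have [measurable]: "s \<in> space S" "a \<in> space A"
    using sa by (auto simp: sa_eq space_pair_measure)
  note [measurable] = mdp.reward_measurable policy.density_measurable
  let ?f = "\<lambda>((s', a'), z). R (s, a, s') + \<gamma> * (z - \<alpha> * ln (p s' a'))"
  have f: "?f \<in> borel_measurable ((S \<Otimes>\<^sub>M A) \<Otimes>\<^sub>M borel)"
  proof -
    \<comment> \<open>The nested pattern is written with projections, but \<open>p\<close> stays
      uncurried on \<open>fst w\<close>, the form in which its joint measurability is given.\<close>
    have "(\<lambda>w. R (s, a, fst (fst w)) + \<gamma> * (snd w - \<alpha> * ln (case fst w of (s', a') \<Rightarrow> p s' a')))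
        \<in> borel_measurable ((S \<Otimes>\<^sub>M A) \<Otimes>\<^sub>M borel)"
      by measurable
    then show ?thesis
      by (simp add: case_prod_beta')
  qed
  have Z: "Z \<in> S \<Otimes>\<^sub>M A \<rightarrow>\<^sub>M prob_algebra borel"
    using field cdf_field
    by (intro measurable_prob_algebra_borel_cdf)
      (auto simp: return_distribution_field_def cdf_fields_def cdf_field_def)
  have N: "next_pair S A P \<pi> (s, a) \<in> space (prob_algebra (S \<Otimes>\<^sub>M A))"
    using mdp.transition_kernel policy.policy_kernel sa unfolding sa_eq
    by (rule next_pair_in_space_prob_algebra)
  \<comment> \<open>Solving the inequality for \<open>z\<close> divides by \<gamma> > 0, which keeps
    its direction. The same real number \<open>ln (p s' a')\<close> stands on both sides, also where
    it is a default value.\<close>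
  have halfline: "{z. R (s, a, s') + \<gamma> * (z - \<alpha> * ln (p s' a')) \<le> x}
      = {..(x - R (s, a, s')) / \<gamma> + \<alpha> * ln (p s' a')}" for s' a' x
    using mdp.discount_pos by (auto simp: field_simps)
  show "cdf_field (soft_bellman S A P R \<gamma> \<alpha> \<pi> p Z) sa
      = cdf_bellman S A P R \<gamma> \<alpha> \<pi> p (cdf_field Z) sa"
  proof
    fix x
    have "cdf_field (soft_bellman S A P R \<gamma> \<alpha> \<pi> p Z) sa x
        = (\<integral>w. measure (Z w) {z \<in> space borel. ?f (w, z) \<in> {..x}} \<partial>next_pair S A P \<pi> (s, a))"
      using measure_distr_bind_pair[OF N Z f, of "{..x}"]
      by (simp add: cdf_field_def soft_bellman_def sa_eq cdf_def next_pair_return_def)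
    \<comment> \<open>The integrands agree pointwise: the measure of each slice is the CDF of
      \<open>Z (s', a')\<close> at the endpoint of the half-line.\<close>
    also have "\<dots> = cdf_bellman S A P R \<gamma> \<alpha> \<pi> p (cdf_field Z) sa x"
      unfolding cdf_bellman_def cdf_field_def sa_eq cdf_def prod.case
      by (intro Bochner_Integration.integral_cong) (auto simp: halfline)
    finally show "cdf_field (soft_bellman S A P R \<gamma> \<alpha> \<pi> p Z) sa x
        = cdf_bellman S A P R \<gamma> \<alpha> \<pi> p (cdf_field Z) sa x" .
  qed
qed

end
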